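(* Let $X$ be a topological space and let $\mathcal{D}$ be the set of all open subsets of $X$ which are local spaces. Then $X$ is (homeomorphic to) the filtrum $\mathrm{Filt}\,M$ of some commutative monoid $M$ if and only if the following conditions hold: (1) $X$ is a $T_0$-space. (2) $X\in\mathcal{D}$. (3) If $D_1, D_2\in\mathcal{D}$, then $D_1\cap D_2\in\mathcal{D}$. (4) $\mathcal{D}$ is a basis of the topology of $X$. (5) If $T=\bigcap_{i\in I} D_i$ with $D_i\in\mathcal{D}$, then $T$ has a neighborhood-poorest element. (6) If $\bigcap_{i\in I} D_i\subseteq D$ with $D, D_i\in\mathcal{D}$, then there is a finite subset $J\subseteq I$ with $\bigcap_{i\in J} D_i\subseteq D$.
   Context: Filtrum of a monoid: let $M$ be a commutative monoid, written multiplicatively with neutral element $1$; $g$ divides $f$ if $f=g\cdot a$ for some $a\in M$. A filter in $M$ is a subset $F\subseteq M$ with $1\in F$, closed under multiplication, and containing with each element all its divisors (the whole monoid is allowed). $\mathrm{Filt}\,M$ is the set of all filters of $M$ with the topology having as basis the sets $D(f)=\{F : f\in F\}$, $f\in M$. Neighborhood relation: in a topological space $X$ let $U(x)$ be the set of all open neighborhoods of $x$, and write $x\preceq y$ if $U(x)\subseteq U(y)$. For a subset $T\subseteq X$, an element $x\in T$ is called a neighborhood-poorest element of $T$ if $x\preceq y$ for all $y\in T$. A topological space is called local if it has a neighborhood-poorest point (an open subset of $X$ is local if it is a local space in the subspace topology). An intersection over the empty index set is $X$. *)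

theory Defs
  imports "HOL-Analysis.Abstract_Topological_Spaces" "HOL-Algebra.Divisibility"
begin

section \<open>The filtrum of a commutative monoid\<close>

definition monoid_filter :: "('m, 'k) monoid_scheme \<Rightarrow> 'm set \<Rightarrow> bool" where
  "monoid_filter M F \<longleftrightarrow>
     F \<subseteq> carrier M \<and> \<one>\<^bsub>M\<^esub> \<in> F \<and>
     (\<forall>f\<in>F. \<forall>g\<in>F. f \<otimes>\<^bsub>M\<^esub> g \<in> F) \<and>
     (\<forall>f\<in>F. \<forall>g\<in>carrier M. g divides\<^bsub>M\<^esub> f \<longrightarrow> g \<in> F)"

definition filt_basic :: "('m, 'k) monoid_scheme \<Rightarrow> 'm \<Rightarrow> 'm set set" where
  "filt_basic M f = {F. monoid_filter M F \<and> f \<in> F}"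

definition filtrum :: "('m, 'k) monoid_scheme \<Rightarrow> 'm set topology" where
  "filtrum M = topology (arbitrary union_of (\<lambda>U. U \<in> filt_basic M ` carrier M))"

lemma filt_basic_Int:
  assumes "comm_monoid M" "f \<in> carrier M" "g \<in> carrier M"
  shows "filt_basic M f \<inter> filt_basic M g = filt_basic M (f \<otimes>\<^bsub>M\<^esub> g)"
proof -
  interpret comm_monoid M by fact
  have "f divides\<^bsub>M\<^esub> (f \<otimes>\<^bsub>M\<^esub> g)"
    using assms unfolding factor_def by blast
  moreover have "g divides\<^bsub>M\<^esub> (f \<otimes>\<^bsub>M\<^esub> g)"
    using assms m_comm unfolding factor_def by blast
  ultimately show ?thesis
    using assms unfolding filt_basic_def monoid_filter_def by blast
qed

text \<open>The sets \<open>filt_basic M f\<close> are closed under intersection, so \<^const>\<open>filtrum\<close> is a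
  genuine topology with these sets as basis, and its points are all filters.\<close>

lemma openin_filtrum:
  assumes "comm_monoid M"
  shows "openin (filtrum M) = arbitrary union_of (\<lambda>U. U \<in> filt_basic M ` carrier M)"
proof -
  interpret comm_monoid M by fact
  have "istopology (arbitrary union_of (\<lambda>U. U \<in> filt_basic M ` carrier M))"
    by (rule istopology_base) (auto simp: filt_basic_Int[OF assms])
  then show ?thesis
    unfolding filtrum_def by (simp add: topology_inverse')
qed

lemma topspace_filtrum:
  assumes "comm_monoid M"
  shows "topspace (filtrum M) = {F. monoid_filter M F}"
proof
  show "topspace (filtrum M) \<subseteq> {F. monoid_filter M F}"
    unfolding topspace_def openin_filtrum[OF assms] union_of_def
    by (auto simp: filt_basic_def)
next
  interpret comm_monoid M by fact
  have "openin (filtrum M) (filt_basic M \<one>\<^bsub>M\<^esub>)"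
    unfolding openin_filtrum[OF assms] by (rule arbitrary_union_of_inc) simp
  then show "{F. monoid_filter M F} \<subseteq> topspace (filtrum M)"
    by (auto simp: filt_basic_def monoid_filter_def dest!: openin_subset)
qed


section \<open>The neighborhood relation and local spaces\<close>

definition open_nbhds :: "'a topology \<Rightarrow> 'a \<Rightarrow> 'a set set" where
  "open_nbhds X x = {U. openin X U \<and> x \<in> U}"

definition nbhd_le :: "'a topology \<Rightarrow> 'a \<Rightarrow> 'a \<Rightarrow> bool" where
  "nbhd_le X x y \<longleftrightarrow> open_nbhds X x \<subseteq> open_nbhds X y"

definition nbhd_poorest :: "'a topology \<Rightarrow> 'a set \<Rightarrow> 'a \<Rightarrow> bool" where
  "nbhd_poorest X T x \<longleftrightarrow> x \<in> T \<and> (\<forall>y\<in>T. nbhd_le X x y)"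

definition local_space :: "'a topology \<Rightarrow> bool" where
  "local_space X \<longleftrightarrow> (\<exists>x. nbhd_poorest X (topspace X) x)"

definition local_opens :: "'a topology \<Rightarrow> 'a set set" where
  "local_opens X = {U. openin X U \<and> local_space (subtopology X U)}"

text \<open>Intersections of families are always taken relative to \<^term>\<open>topspace X\<close>, so that the
  empty intersection is the whole space.\<close>

definition filtrum_conditions :: "'a topology \<Rightarrow> bool" where
  "filtrum_conditions X \<longleftrightarrow>
     t0_space X \<and>
     topspace X \<in> local_opens X \<and>
     (\<forall>D1\<in>local_opens X. \<forall>D2\<in>local_opens X. D1 \<inter> D2 \<in> local_opens X) \<and>
     openin X = arbitrary union_of (\<lambda>U. U \<in> local_opens X) \<and>
     (\<forall>\<C>\<subseteq>local_opens X. \<exists>x. nbhd_poorest X (topspace X \<inter> \<Inter>\<C>) x) \<and>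
     (\<forall>\<C>\<subseteq>local_opens X. \<forall>D\<in>local_opens X. topspace X \<inter> \<Inter>\<C> \<subseteq> D \<longrightarrow>
        (\<exists>\<J>\<subseteq>\<C>. finite \<J> \<and> topspace X \<inter> \<Inter>\<J> \<subseteq> D))"

end

theory Submission
  imports Defs
begin

text \<open>In \<open>Filt M\<close> the neighbourhood relation is inclusion of filters, so a set \<open>D(f)\<close> is local
  with poorest point the smallest filter containing \<open>f\<close>.  Conversely, if an open set \<open>U\<close> has a
  poorest point \<open>F\<close>, then \<open>F \<in> D(f) \<subseteq> U\<close> for some \<open>f\<close>, and since every neighbourhood of \<open>F\<close>
  contains all of \<open>U\<close>, \<open>U = D(f)\<close>.  Hence the local open sets are exactly the sets \<open>D(f)\<close>
  (\<open>local_opens_chart\<close>), and the conditions become facts about filters: intersections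
  of the \<open>D(f)\<close> are the sets of filters containing a given set \<open>S\<close>, a smallest such filter exists
  because filters are closed under intersection, and each of its elements already lies in every
  filter containing a certain finite part of \<open>S\<close> (\<open>finitely_forced_filter\<close>).

  For the other direction, the monoid is recovered from the space: it is the set of local open
  sets under intersection, where divisibility is reverse inclusion.  A point \<open>x\<close> is sent to the
  filter of the local open sets containing it.  This is injective by the separation axiom, and
  surjective because a filter \<open>\<F>\<close> comes from the poorest point of \<open>\<Inter>\<F>\<close>: a local open set around
  that point contains \<open>\<Inter>\<F>\<close>, hence a finite subintersection, and so is a divisor of an
  element of \<open>\<F>\<close> (\<open>points_are_filters\<close>).

  Both directions refer to a bijection from the points of \<open>X\<close> to filters under
  which the sets \<open>D(f)\<close> become a basis of \<open>X\<close> (\<open>filter_chart\<close>).  This makes it possible to argue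
  inside \<open>X\<close> throughout, without transporting the conditions along a homeomorphism.\<close>

section \<open>Neighbourhoods and local open sets\<close>

text \<open>On an open subspace the neighbourhood relation is the restriction of that of \<open>X\<close>, so
  locality can be tested in \<open>X\<close> itself.\<close>

lemma local_opens_iff:
  "U \<in> local_opens X \<longleftrightarrow> openin X U \<and> (\<exists>x. nbhd_poorest X U x)"
proof (cases "openin X U")
  case True
  then have U: "U \<subseteq> topspace X" by (rule openin_subset)
  then have top: "topspace (subtopology X U) = U" by auto
  have "nbhd_le (subtopology X U) x y \<longleftrightarrow> nbhd_le X x y" if "x \<in> U" "y \<in> U" for x y
    using that unfolding nbhd_le_def open_nbhds_def openin_subtopology by blast
  then have "nbhd_poorest (subtopology X U) U = nbhd_poorest X U"
    unfolding nbhd_poorest_def by blast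
  with True top show ?thesis
    unfolding local_opens_def local_space_def by simp
qed (simp add: local_opens_def)

lemma nbhd_poorest_subset_nbhd:
  assumes "nbhd_poorest X T x" "openin X U" "x \<in> U"
  shows "T \<subseteq> U"
  using assms unfolding nbhd_poorest_def nbhd_le_def open_nbhds_def by blast

section \<open>Generation of filters\<close>

lemma monoid_filter_Inter:
  assumes "\<F> \<noteq> {}" "\<And>F. F \<in> \<F> \<Longrightarrow> monoid_filter M F"
  shows "monoid_filter M (\<Inter>\<F>)"
  using assms unfolding monoid_filter_def by blast

lemma monoid_filter_carrier:
  assumes "comm_monoid M"
  shows "monoid_filter M (carrier M)"
proof -
  interpret comm_monoid M by fact
  show ?thesis unfolding monoid_filter_def by auto
qed

lemma least_filter_exists:
  assumes "comm_monoid M" "S \<subseteq> carrier M"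
  obtains F where "monoid_filter M F" "S \<subseteq> F"
    "\<And>G. monoid_filter M G \<Longrightarrow> S \<subseteq> G \<Longrightarrow> F \<subseteq> G"
proof
  let ?\<F> = "{F. monoid_filter M F \<and> S \<subseteq> F}"
  show "monoid_filter M (\<Inter>?\<F>)"
    using monoid_filter_carrier[OF assms(1)] assms(2) by (intro monoid_filter_Inter) auto
qed auto

text \<open>Membership in a generated filter involves only finitely many generators.  Phrasing this
  through all filters containing a finite set avoids products and powers of generators.\<close>

lemma finitely_forced_filter:
  assumes "comm_monoid M"
  shows "monoid_filter M {f \<in> carrier M. \<exists>J\<subseteq>S. finite J \<and> (\<forall>G. monoid_filter M G \<and> J \<subseteq> G \<longrightarrow> f \<in> G)}"
    (is "monoid_filter M ?F")
proof -
  interpret comm_monoid M by fact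
  have "f \<otimes>\<^bsub>M\<^esub> g \<in> ?F" if f: "f \<in> ?F" and g: "g \<in> ?F" for f g
  proof -
    obtain J where J: "J \<subseteq> S" "finite J" "\<And>G. monoid_filter M G \<Longrightarrow> J \<subseteq> G \<Longrightarrow> f \<in> G"
      using f by blast
    obtain K where K: "K \<subseteq> S" "finite K" "\<And>G. monoid_filter M G \<Longrightarrow> K \<subseteq> G \<Longrightarrow> g \<in> G"
      using g by blast
    have "f \<otimes>\<^bsub>M\<^esub> g \<in> G" if "monoid_filter M G" "J \<union> K \<subseteq> G" for G
      using that J(3)[of G] K(3)[of G] unfolding monoid_filter_def by simp
    moreover have "J \<union> K \<subseteq> S" "finite (J \<union> K)" using J K by auto
    ultimately have "\<exists>L\<subseteq>S. finite L \<and> (\<forall>G. monoid_filter M G \<and> L \<subseteq> G \<longrightarrow> f \<otimes>\<^bsub>M\<^esub> g \<in> G)"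
      by blast
    with f g show ?thesis by simp
  qed
  moreover have "g \<in> ?F" if f: "f \<in> ?F" and g: "g \<in> carrier M" "g divides\<^bsub>M\<^esub> f" for f g
  proof -
    obtain J where J: "J \<subseteq> S" "finite J" "\<And>G. monoid_filter M G \<Longrightarrow> J \<subseteq> G \<Longrightarrow> f \<in> G"
      using f by blast
    have "g \<in> G" if "monoid_filter M G" "J \<subseteq> G" for G
      using that J(3)[of G] g unfolding monoid_filter_def by blast
    with J g show ?thesis by blast
  qed
  moreover have "\<one>\<^bsub>M\<^esub> \<in> ?F"
    unfolding monoid_filter_def by (auto intro!: exI[of _ "{}"])
  moreover have "?F \<subseteq> carrier M" by (rule Collect_restrict)
  ultimately show ?thesis
    unfolding monoid_filter_def[of M ?F] by (intro conjI ballI impI)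
qed

section \<open>Charts by filters\<close>

definition chart_basic :: "'a topology \<Rightarrow> ('a \<Rightarrow> 'm set) \<Rightarrow> 'm \<Rightarrow> 'a set" where
  "chart_basic X h f = {x \<in> topspace X. f \<in> h x}"

definition filter_chart :: "('m, 'k) monoid_scheme \<Rightarrow> 'a topology \<Rightarrow> ('a \<Rightarrow> 'm set) \<Rightarrow> bool" where
  "filter_chart M X h \<longleftrightarrow>
     bij_betw h (topspace X) {F. monoid_filter M F} \<and>
     openin X = arbitrary union_of (\<lambda>U. U \<in> chart_basic X h ` carrier M)"

lemma homeomorphic_filtrum_iff_chart:
  fixes M :: "('m, 'k) monoid_scheme"
  assumes M: "comm_monoid M"
  shows "X homeomorphic_space filtrum M \<longleftrightarrow> (\<exists>h. filter_chart M X h)"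
proof
  assume "X homeomorphic_space filtrum M"
  then obtain h where h: "homeomorphic_map X (filtrum M) h"
    using homeomorphic_space by blast
  have bij: "bij_betw h (topspace X) {F. monoid_filter M F}"
    using h topspace_filtrum[OF M] unfolding homeomorphic_eq_everything_map bij_betw_def by simp
  have img: "h ` chart_basic X h f = filt_basic M f" for f
    using bij unfolding bij_betw_def chart_basic_def filt_basic_def by blast
  have sub: "chart_basic X h f \<subseteq> topspace X" for f
    unfolding chart_basic_def by blast
  have basic_open: "openin X (chart_basic X h f)" if "f \<in> carrier M" for f
  proof -
    have "openin (filtrum M) (filt_basic M f)"
      unfolding openin_filtrum[OF M] using that by (intro arbitrary_union_of_inc) auto
    then show ?thesis
      using homeomorphic_map_openness[OF h sub] img by simp
  qed
  have "\<exists>B. B \<in> chart_basic X h ` carrier M \<and> x \<in> B \<and> B \<subseteq> U"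
    if U: "openin X U" "x \<in> U" for U x
  proof -
    have US: "U \<subseteq> topspace X" using U by (simp add: openin_subset)
    have "openin (filtrum M) (h ` U)"
      using homeomorphic_map_openness[OF h US] U by simp
    then obtain f where f: "f \<in> carrier M" "h x \<in> filt_basic M f" "filt_basic M f \<subseteq> h ` U"
      using U(2) unfolding openin_filtrum[OF M] arbitrary_union_of_alt by blast
    have "chart_basic X h f \<subseteq> U"
    proof
      fix y assume y: "y \<in> chart_basic X h f"
      then obtain z where "z \<in> U" "h y = h z" using f(3) img[of f] by blast
      then show "y \<in> U"
        using inj_onD[OF bij_betw_imp_inj_on[OF bij]] y sub[of f] US by blast
    qed
    moreover have "x \<in> chart_basic X h f"
      using f(2) U US unfolding filt_basic_def chart_basic_def by blast
    ultimately show ?thesis using f(1) by blast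
  qed
  then have "openin X = arbitrary union_of (\<lambda>U. U \<in> chart_basic X h ` carrier M)"
    using basic_open by (subst openin_topology_base_unique) auto
  with bij show "\<exists>h. filter_chart M X h" unfolding filter_chart_def by blast
next
  assume "\<exists>h. filter_chart M X h"
  then obtain h where bij: "bij_betw h (topspace X) {F. monoid_filter M F}"
    and base: "openin X = arbitrary union_of (\<lambda>U. U \<in> chart_basic X h ` carrier M)"
    unfolding filter_chart_def by blast
  have img: "h ` chart_basic X h f = filt_basic M f" for f
    using bij unfolding bij_betw_def chart_basic_def filt_basic_def by blast
  have "openin X {x \<in> topspace X. h x \<in> V}" if V: "openin (filtrum M) V" for V
    unfolding base arbitrary_union_of_alt
  proof
    fix x assume x: "x \<in> {x \<in> topspace X. h x \<in> V}"
    then obtain f where f: "f \<in> carrier M" "h x \<in> filt_basic M f" "filt_basic M f \<subseteq> V"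
      using V unfolding openin_filtrum[OF M] arbitrary_union_of_alt by blast
    have "chart_basic X h f \<subseteq> {x \<in> topspace X. h x \<in> V}"
      using f(3) img[of f] unfolding chart_basic_def by blast
    moreover have "x \<in> chart_basic X h f"
      using f(2) x unfolding filt_basic_def chart_basic_def by blast
    ultimately show "\<exists>U. U \<in> chart_basic X h ` carrier M \<and> x \<in> U \<and> U \<subseteq> {x \<in> topspace X. h x \<in> V}"
      using f(1) by blast
  qed
  then have "continuous_map X (filtrum M) h"
    using bij topspace_filtrum[OF M] unfolding continuous_map_def bij_betw_def by auto
  moreover have "openin (filtrum M) (h ` U)" if "openin X U" for U
    unfolding openin_filtrum[OF M] arbitrary_union_of_alt
  proof
    fix F assume "F \<in> h ` U"
    then obtain x where x: "x \<in> U" "F = h x" by blast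
    with that obtain f where "f \<in> carrier M" "x \<in> chart_basic X h f" "chart_basic X h f \<subseteq> U"
      unfolding base arbitrary_union_of_alt by blast
    then show "\<exists>V. V \<in> filt_basic M ` carrier M \<and> F \<in> V \<and> V \<subseteq> h ` U"
      using img[of f] x by blast
  qed
  then have "open_map X (filtrum M) h" unfolding open_map_def by blast
  ultimately have "homeomorphic_map X (filtrum M) h"
    using bij topspace_filtrum[OF M] unfolding bij_betw_def
    by (intro bijective_open_imp_homeomorphic_map) auto
  then show "X homeomorphic_space filtrum M"
    using homeomorphic_space by blast
qed

section \<open>The conditions hold in a filtrum\<close>

context
  fixes M :: "('m, 'k) monoid_scheme" and X :: "'a topology" and h :: "'a \<Rightarrow> 'm set"
  assumes M: "comm_monoid M" and chart: "filter_chart M X h"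
begin

lemma chart_bij: "bij_betw h (topspace X) {F. monoid_filter M F}"
  using chart unfolding filter_chart_def by (rule conjunct1)

lemma chart_filter: "x \<in> topspace X \<Longrightarrow> monoid_filter M (h x)"
  using bij_betwE[OF chart_bij] by simp

lemma chart_point:
  assumes "monoid_filter M F"
  obtains x where "x \<in> topspace X" "h x = F"
proof -
  have "F \<in> h ` topspace X" using bij_betw_imp_surj_on[OF chart_bij] assms by simp
  then show thesis using that by blast
qed

lemma chart_inj: "x \<in> topspace X \<Longrightarrow> y \<in> topspace X \<Longrightarrow> h x = h y \<Longrightarrow> x = y"
  using inj_onD[OF bij_betw_imp_inj_on[OF chart_bij]] by blast

lemma openin_chart:
  "openin X U \<longleftrightarrow>
     (\<forall>x\<in>U. \<exists>f\<in>carrier M. x \<in> chart_basic X h f \<and> chart_basic X h f \<subseteq> U)"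
proof -
  have base: "openin X = arbitrary union_of (\<lambda>U. U \<in> chart_basic X h ` carrier M)"
    using chart unfolding filter_chart_def by (rule conjunct2)
  show ?thesis unfolding base arbitrary_union_of_alt by blast
qed

lemma openin_chart_basic:
  "f \<in> carrier M \<Longrightarrow> openin X (chart_basic X h f)"
  unfolding openin_chart by blast

lemma nbhd_le_chart:
  assumes "x \<in> topspace X" "y \<in> topspace X"
  shows "nbhd_le X x y \<longleftrightarrow> h x \<subseteq> h y"
proof
  assume le: "nbhd_le X x y"
  show "h x \<subseteq> h y"
  proof
    fix f assume f: "f \<in> h x"
    then have "f \<in> carrier M"
      using chart_filter[OF assms(1)] unfolding monoid_filter_def by blast
    with f assms le show "f \<in> h y"
      using openin_chart_basic[of f] unfolding nbhd_le_def open_nbhds_def chart_basic_def by blast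
  qed
next
  assume le: "h x \<subseteq> h y"
  have "y \<in> U" if U: "openin X U" "x \<in> U" for U
  proof -
    obtain f where "x \<in> chart_basic X h f" "chart_basic X h f \<subseteq> U"
      using U openin_chart by blast
    then show ?thesis using le assms(2) unfolding chart_basic_def by blast
  qed
  then show "nbhd_le X x y" unfolding nbhd_le_def open_nbhds_def by blast
qed

lemma poorest_in_chart_Inter:
  assumes "S \<subseteq> carrier M"
  shows "\<exists>x. nbhd_poorest X (topspace X \<inter> \<Inter>(chart_basic X h ` S)) x"
proof -
  obtain F where F: "monoid_filter M F" "S \<subseteq> F"
    "\<And>G. monoid_filter M G \<Longrightarrow> S \<subseteq> G \<Longrightarrow> F \<subseteq> G"
    using least_filter_exists[OF M assms] by blast
  obtain x where x: "x \<in> topspace X" "h x = F" using chart_point[OF F(1)] .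
  have "nbhd_le X x y" if "y \<in> topspace X \<inter> \<Inter>(chart_basic X h ` S)" for y
  proof -
    have "y \<in> topspace X" "S \<subseteq> h y" using that unfolding chart_basic_def by auto
    then show ?thesis using nbhd_le_chart[of x y] x F(3) chart_filter by simp
  qed
  moreover have "x \<in> topspace X \<inter> \<Inter>(chart_basic X h ` S)"
    using x F(2) unfolding chart_basic_def by blast
  ultimately show ?thesis unfolding nbhd_poorest_def by blast
qed

lemma local_opens_chart:
  "local_opens X = chart_basic X h ` carrier M"
proof
  show "local_opens X \<subseteq> chart_basic X h ` carrier M"
  proof
    fix U assume "U \<in> local_opens X"
    then obtain x where U: "openin X U" and x: "nbhd_poorest X U x"
      unfolding local_opens_iff by blast
    have "x \<in> U" using x unfolding nbhd_poorest_def by blast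
    then obtain f where f: "f \<in> carrier M" "x \<in> chart_basic X h f" "chart_basic X h f \<subseteq> U"
      using U unfolding openin_chart by blast
    have "U \<subseteq> chart_basic X h f"
      using nbhd_poorest_subset_nbhd[OF x openin_chart_basic[OF f(1)] f(2)] .
    with f show "U \<in> chart_basic X h ` carrier M" by blast
  qed
next
  have "chart_basic X h f \<in> local_opens X" if f: "f \<in> carrier M" for f
  proof -
    have "topspace X \<inter> \<Inter>(chart_basic X h ` {f}) = chart_basic X h f"
      unfolding chart_basic_def by blast
    then show ?thesis
      using poorest_in_chart_Inter[of "{f}"] openin_chart_basic[OF f] f
      unfolding local_opens_iff by simp
  qed
  then show "chart_basic X h ` carrier M \<subseteq> local_opens X" by (rule image_subsetI)
qed

lemma t0_space_chart: "t0_space X"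
  unfolding t0_space_def
proof (intro ballI impI)
  fix x y assume xy: "x \<in> topspace X" "y \<in> topspace X" "x \<noteq> y"
  then have "h x \<noteq> h y" using chart_inj by blast
  then have "\<not> nbhd_le X x y \<or> \<not> nbhd_le X y x"
    using nbhd_le_chart xy by blast
  then show "\<exists>U. openin X U \<and> (x \<notin> U \<longleftrightarrow> y \<in> U)"
    unfolding nbhd_le_def open_nbhds_def by blast
qed

text \<open>The filter of elements forced by finitely many members of \<open>S\<close> contains \<open>S\<close>, so as a point
  it lies in the given intersection, hence contains \<open>f\<close>; the finite set forcing \<open>f\<close> is the one
  wanted.\<close>

lemma chart_Inter_finite_subintersection:
  assumes S: "S \<subseteq> carrier M" and f: "f \<in> carrier M"
    and sub: "topspace X \<inter> \<Inter>(chart_basic X h ` S) \<subseteq> chart_basic X h f"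
  shows "\<exists>J\<subseteq>S. finite J \<and> topspace X \<inter> \<Inter>(chart_basic X h ` J) \<subseteq> chart_basic X h f"
proof -
  define F where "F = {f \<in> carrier M. \<exists>J\<subseteq>S. finite J \<and> (\<forall>G. monoid_filter M G \<and> J \<subseteq> G \<longrightarrow> f \<in> G)}"
  have "monoid_filter M F" unfolding F_def by (rule finitely_forced_filter[OF M])
  then obtain x where x: "x \<in> topspace X" "h x = F" by (rule chart_point)
  have "S \<subseteq> F"
  proof
    fix s assume "s \<in> S"
    then have "{s} \<subseteq> S \<and> finite {s} \<and> (\<forall>G. monoid_filter M G \<and> {s} \<subseteq> G \<longrightarrow> s \<in> G)" by simp
    with \<open>s \<in> S\<close> S show "s \<in> F" unfolding F_def by blast
  qed
  with x sub have "f \<in> F" unfolding chart_basic_def by blast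
  then obtain J where J: "J \<subseteq> S" "finite J" "\<And>G. monoid_filter M G \<Longrightarrow> J \<subseteq> G \<Longrightarrow> f \<in> G"
    unfolding F_def by blast
  have "topspace X \<inter> \<Inter>(chart_basic X h ` J) \<subseteq> chart_basic X h f"
    using J(3) chart_filter unfolding chart_basic_def by blast
  with J show ?thesis by blast
qed

lemma filtrum_conditions_chart: "filtrum_conditions X"
proof -
  interpret comm_monoid M by (rule M)
  have top: "chart_basic X h \<one>\<^bsub>M\<^esub> = topspace X"
    using chart_filter unfolding chart_basic_def monoid_filter_def by blast
  have int: "chart_basic X h f \<inter> chart_basic X h g = chart_basic X h (f \<otimes>\<^bsub>M\<^esub> g)"
    if "f \<in> carrier M" "g \<in> carrier M" for f g
  proof -
    have "f \<in> h x \<and> g \<in> h x \<longleftrightarrow> f \<otimes>\<^bsub>M\<^esub> g \<in> h x" if "x \<in> topspace X" for x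
      using filt_basic_Int[OF M \<open>f \<in> carrier M\<close> \<open>g \<in> carrier M\<close>] chart_filter[OF that]
      unfolding filt_basic_def by blast
    then show ?thesis unfolding chart_basic_def by blast
  qed
  show ?thesis
    unfolding filtrum_conditions_def local_opens_chart
  proof (intro conjI allI impI ballI)
    show "t0_space X" by (rule t0_space_chart)
    show "topspace X \<in> chart_basic X h ` carrier M" using top by (metis imageI one_closed)
    show "openin X = arbitrary union_of (\<lambda>U. U \<in> chart_basic X h ` carrier M)"
      using chart unfolding filter_chart_def by (rule conjunct2)
    show "D1 \<inter> D2 \<in> chart_basic X h ` carrier M"
      if "D1 \<in> chart_basic X h ` carrier M" "D2 \<in> chart_basic X h ` carrier M" for D1 D2
      using that int by auto
    show "\<exists>x. nbhd_poorest X (topspace X \<inter> \<Inter>\<C>) x"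
      if "\<C> \<subseteq> chart_basic X h ` carrier M" for \<C>
      using that poorest_in_chart_Inter unfolding subset_image_iff by blast
    show "\<exists>\<J>\<subseteq>\<C>. finite \<J> \<and> topspace X \<inter> \<Inter>\<J> \<subseteq> D"
      if "\<C> \<subseteq> chart_basic X h ` carrier M" "D \<in> chart_basic X h ` carrier M"
        "topspace X \<inter> \<Inter>\<C> \<subseteq> D" for \<C> D
    proof -
      obtain S where S: "S \<subseteq> carrier M" "\<C> = chart_basic X h ` S"
        using \<open>\<C> \<subseteq> _\<close> unfolding subset_image_iff by blast
      obtain f where f: "f \<in> carrier M" "D = chart_basic X h f" using \<open>D \<in> _\<close> by blast
      obtain J where "J \<subseteq> S" "finite J" "topspace X \<inter> \<Inter>(chart_basic X h ` J) \<subseteq> D"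
        using chart_Inter_finite_subintersection[OF S(1) f(1)] \<open>topspace X \<inter> \<Inter>\<C> \<subseteq> D\<close>
        unfolding S(2) f(2) by blast
      then have "chart_basic X h ` J \<subseteq> \<C> \<and> finite (chart_basic X h ` J)
          \<and> topspace X \<inter> \<Inter>(chart_basic X h ` J) \<subseteq> D"
        using S by blast
      then show ?thesis by blast
    qed
  qed
qed

end

section \<open>Recovering a monoid from a space\<close>

definition local_opens_monoid :: "'a topology \<Rightarrow> 'a set monoid" where
  "local_opens_monoid X = \<lparr>carrier = local_opens X, mult = (\<inter>), one = topspace X\<rparr>"

lemma local_opens_monoid_simps [simp]:
  "carrier (local_opens_monoid X) = local_opens X"
  "D \<otimes>\<^bsub>local_opens_monoid X\<^esub> E = D \<inter> E"
  "\<one>\<^bsub>local_opens_monoid X\<^esub> = topspace X"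
  by (simp_all add: local_opens_monoid_def)

lemma local_opens_subset: "D \<in> local_opens X \<Longrightarrow> D \<subseteq> topspace X"
  by (simp add: local_opens_def openin_subset)

lemma comm_monoid_local_opens:
  assumes "filtrum_conditions X"
  shows "comm_monoid (local_opens_monoid X)"
proof (rule comm_monoidI)
  show "D \<otimes>\<^bsub>local_opens_monoid X\<^esub> E \<in> carrier (local_opens_monoid X)"
    if "D \<in> carrier (local_opens_monoid X)" "E \<in> carrier (local_opens_monoid X)" for D E
    using assms that unfolding filtrum_conditions_def by simp
  show "\<one>\<^bsub>local_opens_monoid X\<^esub> \<in> carrier (local_opens_monoid X)"
    using assms unfolding filtrum_conditions_def by simp
  show "\<one>\<^bsub>local_opens_monoid X\<^esub> \<otimes>\<^bsub>local_opens_monoid X\<^esub> D = D"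
    if "D \<in> carrier (local_opens_monoid X)" for D
    using that local_opens_subset[of D X] by (simp add: Int_absorb1)
qed (simp_all add: Int_ac)

lemma divides_local_opens_iff:
  assumes "D \<in> local_opens X" "E \<in> local_opens X"
  shows "E divides\<^bsub>local_opens_monoid X\<^esub> D \<longleftrightarrow> D \<subseteq> E"
  using assms Int_absorb1[of D E] unfolding factor_def by auto

lemma monoid_filter_local_opens_iff:
  "monoid_filter (local_opens_monoid X) \<F> \<longleftrightarrow>
     \<F> \<subseteq> local_opens X \<and> topspace X \<in> \<F> \<and> (\<forall>D\<in>\<F>. \<forall>E\<in>\<F>. D \<inter> E \<in> \<F>) \<and>
     (\<forall>D\<in>\<F>. \<forall>E\<in>local_opens X. D \<subseteq> E \<longrightarrow> E \<in> \<F>)"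
proof (cases "\<F> \<subseteq> local_opens X")
  case True
  then have "(\<forall>D\<in>\<F>. \<forall>E\<in>local_opens X. E divides\<^bsub>local_opens_monoid X\<^esub> D \<longrightarrow> E \<in> \<F>) \<longleftrightarrow>
      (\<forall>D\<in>\<F>. \<forall>E\<in>local_opens X. D \<subseteq> E \<longrightarrow> E \<in> \<F>)"
    by (intro ball_cong refl) (simp add: divides_local_opens_iff subset_iff)
  then show ?thesis unfolding monoid_filter_def by simp
qed (simp add: monoid_filter_def)

text \<open>A filter \<open>\<F>\<close> of local open sets is recovered from the poorest point of its intersection.
  A local open set \<open>D\<close> around this point contains the whole intersection, so by the finiteness
  condition it contains a finite subintersection, which is an element of \<open>\<F>\<close> because \<open>\<F>\<close> is
  closed under products; hence \<open>D\<close>, being a divisor of it, belongs to \<open>\<F>\<close>.\<close>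

lemma points_are_filters:
  assumes "filtrum_conditions X"
  shows "bij_betw (\<lambda>x. {D \<in> local_opens X. x \<in> D}) (topspace X)
           {\<F>. monoid_filter (local_opens_monoid X) \<F>}"
  unfolding bij_betw_def
proof
  have t0: "t0_space X"
    and one: "topspace X \<in> local_opens X"
    and int: "\<forall>D\<in>local_opens X. \<forall>E\<in>local_opens X. D \<inter> E \<in> local_opens X"
    and base: "openin X = arbitrary union_of (\<lambda>U. U \<in> local_opens X)"
    and poorest: "\<forall>\<C>\<subseteq>local_opens X. \<exists>x. nbhd_poorest X (topspace X \<inter> \<Inter>\<C>) x"
    and fin: "\<forall>\<C>\<subseteq>local_opens X. \<forall>D\<in>local_opens X. topspace X \<inter> \<Inter>\<C> \<subseteq> D \<longrightarrow>
        (\<exists>\<J>\<subseteq>\<C>. finite \<J> \<and> topspace X \<inter> \<Inter>\<J> \<subseteq> D)"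
    using assms unfolding filtrum_conditions_def by auto
  let ?h = "\<lambda>x. {D \<in> local_opens X. x \<in> D}"
  show "inj_on ?h (topspace X)"
  proof (rule inj_onI, rule ccontr)
    fix x y assume xy: "x \<in> topspace X" "y \<in> topspace X" "?h x = ?h y" "x \<noteq> y"
    then obtain U where U: "openin X U" "x \<notin> U \<longleftrightarrow> y \<in> U"
      using t0 unfolding t0_space_def by blast
    have "\<exists>D\<in>local_opens X. z \<in> D \<and> D \<subseteq> U" if "z \<in> U" for z
      using U(1) that unfolding base arbitrary_union_of_alt by blast
    with U(2) xy(3) show False by blast
  qed
  show "?h ` topspace X = {\<F>. monoid_filter (local_opens_monoid X) \<F>}"
  proof
    show "?h ` topspace X \<subseteq> {\<F>. monoid_filter (local_opens_monoid X) \<F>}"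
      using one int unfolding monoid_filter_local_opens_iff by auto
    show "{\<F>. monoid_filter (local_opens_monoid X) \<F>} \<subseteq> ?h ` topspace X"
    proof
      fix \<F> assume "\<F> \<in> {\<F>. monoid_filter (local_opens_monoid X) \<F>}"
      then have \<F>: "\<F> \<subseteq> local_opens X" "topspace X \<in> \<F>" "\<And>D E. D \<in> \<F> \<Longrightarrow> E \<in> \<F> \<Longrightarrow> D \<inter> E \<in> \<F>"
          "\<And>D E. D \<in> \<F> \<Longrightarrow> E \<in> local_opens X \<Longrightarrow> D \<subseteq> E \<Longrightarrow> E \<in> \<F>"
        unfolding monoid_filter_local_opens_iff by blast+
      obtain x where x: "nbhd_poorest X (topspace X \<inter> \<Inter>\<F>) x"
        using poorest \<F>(1) by blast
      then have xT: "x \<in> topspace X \<inter> \<Inter>\<F>" unfolding nbhd_poorest_def by blast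
      have finite_Inter: "topspace X \<inter> \<Inter>\<J> \<in> \<F>" if "finite \<J>" "\<J> \<subseteq> \<F>" for \<J>
        using that
      proof (induction \<J>)
        case (insert D \<J>)
        then have "D \<inter> (topspace X \<inter> \<Inter>\<J>) \<in> \<F>" using \<F>(3) by simp
        then show ?case by (simp add: Int_left_commute)
      qed (simp add: \<F>(2))
      have "D \<in> \<F>" if D: "D \<in> local_opens X" "x \<in> D" for D
      proof -
        have "openin X D" using D(1) unfolding local_opens_def by blast
        then have "topspace X \<inter> \<Inter>\<F> \<subseteq> D" using nbhd_poorest_subset_nbhd[OF x] D(2) by blast
        then obtain \<J> where \<J>: "\<J> \<subseteq> \<F>" "finite \<J>" "topspace X \<inter> \<Inter>\<J> \<subseteq> D"
          using fin[rule_format, OF \<F>(1) D(1)] by blast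
        show ?thesis using \<F>(4)[OF finite_Inter[OF \<J>(2,1)] D(1) \<J>(3)] .
      qed
      then have "?h x = \<F>" using xT \<F>(1) by blast
      then show "\<F> \<in> ?h ` topspace X" using xT by blast
    qed
  qed
qed

lemma filter_chart_local_opens:
  assumes "filtrum_conditions X"
  shows "filter_chart (local_opens_monoid X) X (\<lambda>x. {D \<in> local_opens X. x \<in> D})"
proof -
  have "chart_basic X (\<lambda>x. {D \<in> local_opens X. x \<in> D}) D = D" if "D \<in> local_opens X" for D
    using that local_opens_subset[OF that] unfolding chart_basic_def by blast
  then have "chart_basic X (\<lambda>x. {D \<in> local_opens X. x \<in> D}) ` local_opens X = local_opens X"
    by (simp cong: image_cong)
  then show ?thesis
    using assms points_are_filters[OF assms]
    unfolding filter_chart_def filtrum_conditions_def by simp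
qed

section \<open>The characterization\<close>

lemma filtrum_conditions_if_homeomorphic:
  assumes "comm_monoid M" "X homeomorphic_space filtrum M"
  shows "filtrum_conditions X"
  using assms(2) filtrum_conditions_chart[OF assms(1)]
  unfolding homeomorphic_filtrum_iff_chart[OF assms(1)] by blast

(* Types cannot be quantified in HOL. The first conjunct is the equivalence with the monoid
   taken on the type of subsets of X; the second gives the forward implication for a monoid
   over an arbitrary type 'm. *)
theorem mainTheorem3:
  fixes X :: "'a topology"
  shows "((\<exists>M :: 'a set monoid. comm_monoid M \<and> X homeomorphic_space filtrum M)
            \<longleftrightarrow> filtrum_conditions X) \<and>
         (\<forall>M :: 'm monoid. comm_monoid M \<and> X homeomorphic_space filtrum M
            \<longrightarrow> filtrum_conditions X)"
proof (intro conjI iffI allI impI)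
  assume X: "filtrum_conditions X"
  then have "X homeomorphic_space filtrum (local_opens_monoid X)"
    using homeomorphic_filtrum_iff_chart[OF comm_monoid_local_opens[OF X]]
      filter_chart_local_opens[OF X] by blast
  with comm_monoid_local_opens[OF X]
  show "\<exists>M :: 'a set monoid. comm_monoid M \<and> X homeomorphic_space filtrum M" by blast
qed (auto intro: filtrum_conditions_if_homeomorphic)

end
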